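(* Let $(X,Y)$ be a norming dual pair and let $(\Omega,\mathscr{F},m)$ be a $\sigma$-finite measure space. Assume that there exists a consistent locally convex topology $\tau$ on $X$ such that $(X,\tau)$ is quasi-complete. Let $f:\Omega\to X$ be a function which is almost $\tau$-separably valued and scalarly $Y$-integrable, and such that $\|f\|$ is majorized by an integrable function. Then $f$ is $Y$-integrable, i.e. for every $A\in\mathscr{F}$ the $Y$-integral $\int_A f\,dm\in Y^*$ belongs to $X$.
   Context: A norming dual pair $(X,Y)$ consists of nontrivial (complex) Banach spaces $X,Y$ and a duality pairing (bilinear form) $\langle\cdot,\cdot\rangle:X\times Y\to\mathbb{C}$ such that $\|x\|_X=\sup\{|\langle x,y\rangle|: y\in Y,\|y\|_Y\le1\}$ for all $x\in X$ and $\|y\|_Y=\sup\{|\langle x,y\rangle|: x\in X,\|x\|_X\le1\}$ for all $y\in Y$. Via the pairing, $X$ is regarded as a (norm-closed, isometrically embedded) subspace of the norm dual $Y^*$, and $Y$ as a subspace of $X^*$. A locally convex topology $\tau$ on $X$ is consistent (with the duality) if $(X,\tau)'=Y$, i.e. the $\tau$-continuous linear functionals on $X$ are exactly the maps $x\mapsto\langle x,y\rangle$ with $y\in Y$. $(X,\tau)$ is quasi-complete if $\tau$ is complete on every bounded, closed subset of $(X,\tau)$. A function $f:\Omega\to X$ is scalarly $Y$-measurable (scalarly $Y$-integrable) if $\omega\mapsto\langle f(\omega),y\rangle$ is measurable (integrable) for every $y\in Y$. If $f$ is scalarly $Y$-integrable and $A\in\mathscr{F}$, then $y\mapsto\int_A\langle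 f(\omega),y\rangle\,dm(\omega)$ is a norm-continuous linear functional on $Y$; it is called the $Y$-integral of $f$ over $A$ and denoted $\int_A f\,dm\in Y^*$. If $\int_A f\,dm\in X\subset Y^*$ for every $A\in\mathscr{F}$, then $f$ is called $Y$-integrable. $f$ is almost $\tau$-separably valued if there exist an $m$-null set $N$ and a $\tau$-separable subspace $X_0$ of $X$ such that $f(\Omega\setminus N)\subset X_0$. "$\|f\|$ is majorized by an integrable function" means there is an integrable $g:\Omega\to[0,\infty)$ with $\|f(\omega)\|\le g(\omega)$. *)

theory Defs
  imports "HOL-Analysis.Analysis"
begin

section \<open>Complex Banach spaces\<close>

text \<open>HOL-Analysis only has real normed spaces. As every complex Banach space is a real one by
  restriction of scalars, the complex scalar multiplication is added on top of \<^class>\<open>banach\<close>.\<close>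

class complex_banach = banach +
  fixes scaleC :: "complex \<Rightarrow> 'a \<Rightarrow> 'a"  (infixr \<open>*\<^sub>C\<close> 75)
  assumes scaleC_add_right: "c *\<^sub>C (x + y) = c *\<^sub>C x + c *\<^sub>C y"
    and scaleC_add_left: "(c + d) *\<^sub>C x = c *\<^sub>C x + d *\<^sub>C x"
    and scaleC_scaleC: "c *\<^sub>C d *\<^sub>C x = (c * d) *\<^sub>C x"
    and scaleC_of_real: "complex_of_real r *\<^sub>C x = r *\<^sub>R x"
    and norm_scaleC: "norm (c *\<^sub>C x) = cmod c * norm x"

lemma vector_space_scaleC: "vector_space (scaleC :: complex \<Rightarrow> 'a \<Rightarrow> 'a::complex_banach)"
proof
  show "1 *\<^sub>C x = x" for x :: 'a
    using scaleC_of_real[of 1 x] by simp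
qed (simp_all add: scaleC_add_right scaleC_add_left scaleC_scaleC)

definition clinear_functional :: "('a::complex_banach \<Rightarrow> complex) \<Rightarrow> bool" where
  "clinear_functional \<phi> \<longleftrightarrow> Vector_Spaces.linear scaleC (*) \<phi>"

definition csubspace :: "'a::complex_banach set \<Rightarrow> bool" where
  "csubspace S \<longleftrightarrow> module.subspace scaleC S"


section \<open>Norming dual pairs\<close>

text \<open>The spaces are the types \<^typ>\<open>'a\<close> and \<^typ>\<open>'b\<close>. The suprema are taken in \<^typ>\<open>ereal\<close>, so that
  the equations include finiteness of the supremum.\<close>

locale norming_dual_pair =
  fixes pair :: "'a::complex_banach \<Rightarrow> 'b::complex_banach \<Rightarrow> complex"
  assumes nontrivial_left: "\<exists>x::'a. x \<noteq> 0"
    and nontrivial_right: "\<exists>y::'b. y \<noteq> 0"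
    and linear_left: "clinear_functional (\<lambda>x. pair x y)"
    and linear_right: "clinear_functional (\<lambda>y. pair x y)"
    and norming_left: "ereal (norm x) = (SUP y\<in>{y. norm y \<le> 1}. ereal (cmod (pair x y)))"
    and norming_right: "ereal (norm y) = (SUP x\<in>{x. norm x \<le> 1}. ereal (cmod (pair x y)))"


section \<open>Locally convex topologies\<close>

text \<open>The Hausdorff property is not part of the definition; it follows for consistent topologies,
  since the second component of a norming dual pair separates the points of the first.\<close>

definition locally_convex_topology :: "'a::complex_banach topology \<Rightarrow> bool" where
  "locally_convex_topology \<tau> \<longleftrightarrow>
     topspace \<tau> = UNIV \<and>
     continuous_map (prod_topology \<tau> \<tau>) \<tau> (\<lambda>(x, y). x + y) \<and>
     continuous_map (prod_topology euclidean \<tau>) \<tau> (\<lambda>(c, x). c *\<^sub>C x) \<and>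
     neighbourhood_base_of convex \<tau>"

definition topological_dual :: "'a::complex_banach topology \<Rightarrow> ('a \<Rightarrow> complex) set" where
  "topological_dual \<tau> = {\<phi>. clinear_functional \<phi> \<and> continuous_map \<tau> euclidean \<phi>}"

definition consistent_topology ::
    "('a::complex_banach \<Rightarrow> 'b::complex_banach \<Rightarrow> complex) \<Rightarrow> 'a topology \<Rightarrow> bool" where
  "consistent_topology pair \<tau> \<longleftrightarrow> topological_dual \<tau> = range (\<lambda>y x. pair x y)"

text \<open>Boundedness with respect to \<open>\<tau>\<close> (von Neumann), not with respect to the norm.\<close>

definition tvs_bounded :: "'a::complex_banach topology \<Rightarrow> 'a set \<Rightarrow> bool" where
  "tvs_bounded \<tau> B \<longleftrightarrow>
     (\<forall>U. openin \<tau> U \<and> 0 \<in> U \<longrightarrow> (\<exists>r>0. \<forall>c. cmod c \<ge> r \<longrightarrow> B \<subseteq> (\<lambda>x. c *\<^sub>C x) ` U))"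

definition tvs_cauchy_filter :: "'a::complex_banach topology \<Rightarrow> 'a filter \<Rightarrow> bool" where
  "tvs_cauchy_filter \<tau> F \<longleftrightarrow>
     (\<forall>U. openin \<tau> U \<and> 0 \<in> U \<longrightarrow> eventually (\<lambda>(x, y). x - y \<in> U) (F \<times>\<^sub>F F))"

text \<open>Completeness for arbitrary filters (equivalently, nets), not just for sequences.\<close>

definition tvs_complete_set :: "'a::complex_banach topology \<Rightarrow> 'a set \<Rightarrow> bool" where
  "tvs_complete_set \<tau> B \<longleftrightarrow>
     (\<forall>F. F \<noteq> bot \<and> F \<le> principal B \<and> tvs_cauchy_filter \<tau> F \<longrightarrow> (\<exists>x\<in>B. limitin \<tau> (\<lambda>z. z) x F))"

definition quasi_complete :: "'a::complex_banach topology \<Rightarrow> bool" where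
  "quasi_complete \<tau> \<longleftrightarrow> (\<forall>B. tvs_bounded \<tau> B \<and> closedin \<tau> B \<longrightarrow> tvs_complete_set \<tau> B)"


section \<open>The Y-integral\<close>

definition almost_separably_valued ::
    "'w measure \<Rightarrow> 'a::complex_banach topology \<Rightarrow> ('w \<Rightarrow> 'a) \<Rightarrow> bool" where
  "almost_separably_valued M \<tau> f \<longleftrightarrow>
     (\<exists>N\<in>null_sets M. \<exists>X\<^sub>0. csubspace X\<^sub>0 \<and> separable_space (subtopology \<tau> X\<^sub>0) \<and>
        f ` (space M - N) \<subseteq> X\<^sub>0)"

definition scalarly_integrable ::
    "('a::complex_banach \<Rightarrow> 'b::complex_banach \<Rightarrow> complex) \<Rightarrow> 'w measure \<Rightarrow> ('w \<Rightarrow> 'a) \<Rightarrow> bool" where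
  "scalarly_integrable pair M f \<longleftrightarrow> (\<forall>y. integrable M (\<lambda>\<omega>. pair (f \<omega>) y))"

text \<open>Elements of the norm dual of \<^typ>\<open>'b\<close> are represented as functions \<^typ>\<open>'b \<Rightarrow> complex\<close>.\<close>

definition Y_integral ::
    "('a::complex_banach \<Rightarrow> 'b::complex_banach \<Rightarrow> complex) \<Rightarrow> 'w measure \<Rightarrow> 'w set \<Rightarrow> ('w \<Rightarrow> 'a)
      \<Rightarrow> ('b \<Rightarrow> complex)" where
  "Y_integral pair M A f = (\<lambda>y. set_lebesgue_integral M A (\<lambda>\<omega>. pair (f \<omega>) y))"

text \<open>The range of the pairing is the canonical image of \<^typ>\<open>'a\<close> in the norm dual of \<^typ>\<open>'b\<close>; an
  element \<open>x\<close> of \<^typ>\<open>'a\<close> is identified with the functional \<open>pair x\<close>.\<close>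

definition Y_integrable ::
    "('a::complex_banach \<Rightarrow> 'b::complex_banach \<Rightarrow> complex) \<Rightarrow> 'w measure \<Rightarrow> ('w \<Rightarrow> 'a) \<Rightarrow> bool" where
  "Y_integrable pair M f \<longleftrightarrow>
     scalarly_integrable pair M f \<and> (\<forall>A\<in>sets M. Y_integral pair M A f \<in> range pair)"

end

theory Submission
  imports Defs
begin

text \<open>
  Passing to the finite measure with density \<open>g\<close> and to \<open>f / g\<close>, one may assume that \<open>M\<close> is finite
  and \<open>\<parallel>f\<parallel> \<le> 1\<close>. Let \<open>W\<close> be an absolutely convex \<open>\<tau>\<close>-neighbourhood of \<open>0\<close>. By \<open>\<tau>\<close>-separability,
  countably many translates of \<open>W\<close> cover the essential range of \<open>f\<close>, and countably many elements of
  the polar of \<open>W\<close> determine its seminorm there up to a constant, so that the preimages of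
  the (enlarged) translates are measurable. Hence \<open>f\<close> is, up to a multiple of \<open>W\<close>, a countably valued function with
  values in the unit ball, whose integral is a norm-convergent series in \<open>X\<close>. It approximates the
  \<open>Y\<close>-integral uniformly on the polar of \<open>W\<close> and has norm at most \<open>m(\<Omega>)\<close>, whatever \<open>W\<close> is. As
  \<open>W\<close> shrinks these approximants form, by the bipolar theorem, a \<open>\<tau>\<close>-Cauchy filter on a norm ball of
  \<open>X\<close>, which is \<open>\<tau>\<close>-closed and (by uniform boundedness) \<open>\<tau>\<close>-bounded. Its limit exists by
  quasi-completeness and represents the \<open>Y\<close>-integral.
\<close>

section \<open>The Hahn-Banach theorem\<close>

text \<open>An inequality for positive factors is enough: applied to the inverse factor it becomes
  an equality, and doubling then gives \<open>p 0 = 0\<close>.\<close>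

definition sublinear :: "('a::real_vector \<Rightarrow> real) \<Rightarrow> bool" where
  "sublinear p \<longleftrightarrow> (\<forall>x y. p (x + y) \<le> p x + p y) \<and> (\<forall>r x. 0 < r \<longrightarrow> p (r *\<^sub>R x) \<le> r * p x)"

lemma sublinear_add: "sublinear p \<Longrightarrow> p (x + y) \<le> p x + p y"
  by (auto simp: sublinear_def)

lemma sublinear_scaleR:
  assumes "sublinear p" "0 < r"
  shows "p (r *\<^sub>R x) = r * p x"
proof (rule antisym)
  show "p (r *\<^sub>R x) \<le> r * p x"
    using assms by (auto simp: sublinear_def)
  have "p (inverse r *\<^sub>R r *\<^sub>R x) \<le> inverse r * p (r *\<^sub>R x)"
    using assms unfolding sublinear_def by (meson positive_imp_inverse_positive)
  then show "r * p x \<le> p (r *\<^sub>R x)"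
    using assms(2) by (simp add: field_simps)
qed

lemma sublinear_0: "sublinear p \<Longrightarrow> p 0 = 0"
  using sublinear_scaleR[of p 2 0] by simp

lemma sublinear_minus: "sublinear p \<Longrightarrow> - p (- x) \<le> p x"
  using sublinear_add[of p x "-x"] sublinear_0[of p] by simp

text \<open>The largest sublinear functional \<open>q \<le> p\<close> with \<open>q (- a) \<le> - p a\<close>. A minimal sublinear functional
  is equal to all of its flattenings, which makes it additive.\<close>

definition flatten :: "('a::real_vector \<Rightarrow> real) \<Rightarrow> 'a \<Rightarrow> 'a \<Rightarrow> real" where
  "flatten p a x = (INF t\<in>{0..}. p (x + t *\<^sub>R a) - t * p a)"

text \<open>Subadditivity for \<open>t *\<^sub>R a = (x + t *\<^sub>R a) + (- x)\<close> bounds the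
  terms below by \<open>- p (- x)\<close>, so the infimum over the reals is meaningful.\<close>

lemma flatten_bdd_below:
  assumes "sublinear p"
  shows "bdd_below ((\<lambda>t. p (x + t *\<^sub>R a) - t * p a) ` {0..})"
proof (rule bdd_belowI2)
  fix t :: real assume t: "t \<in> {0..}"
  have "p (t *\<^sub>R a) = t * p a"
    using sublinear_scaleR[OF assms, of t a] sublinear_0[OF assms] t by (cases "t = 0") auto
  moreover have "p (t *\<^sub>R a) \<le> p (x + t *\<^sub>R a) + p (- x)"
    using sublinear_add[OF assms, of "x + t *\<^sub>R a" "-x"] by simp
  ultimately show "- p (- x) \<le> p (x + t *\<^sub>R a) - t * p a" by simp
qed

lemma flatten_le:
  assumes "sublinear p" "0 \<le> t"
  shows "flatten p a x \<le> p (x + t *\<^sub>R a) - t * p a"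
  unfolding flatten_def using flatten_bdd_below[OF assms(1)] assms(2)
  by (intro cINF_lower) auto

lemma le_flatten:
  assumes "\<And>t. 0 \<le> t \<Longrightarrow> c \<le> p (x + t *\<^sub>R a) - t * p a"
  shows "c \<le> flatten p a x"
  unfolding flatten_def by (rule cINF_greatest) (use assms in auto)

text \<open>Parameters \<open>s\<close> for \<open>x\<close> and \<open>t\<close> for
  \<open>y\<close> combine to \<open>s + t\<close> for \<open>x + y\<close>; the two infima are then
  taken one after the other.\<close>

lemma sublinear_flatten:
  assumes p: "sublinear p"
  shows "sublinear (flatten p a)"
  unfolding sublinear_def
proof (intro conjI allI impI)
  fix x y :: 'a
  have *: "flatten p a (x + y) \<le> (p (x + s *\<^sub>R a) - s * p a) + (p (y + t *\<^sub>R a) - t * p a)"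
    if "0 \<le> s" "0 \<le> t" for s t
  proof -
    have "flatten p a (x + y) \<le> p (x + y + (s + t) *\<^sub>R a) - (s + t) * p a"
      by (rule flatten_le) (use p that in auto)
    also have "x + y + (s + t) *\<^sub>R a = (x + s *\<^sub>R a) + (y + t *\<^sub>R a)"
      by (simp add: algebra_simps)
    finally show ?thesis
      using sublinear_add[OF p, of "x + s *\<^sub>R a" "y + t *\<^sub>R a"] by (simp add: algebra_simps)
  qed
  have "flatten p a (x + y) - (p (x + s *\<^sub>R a) - s * p a) \<le> flatten p a y" if "0 \<le> s" for s
    by (rule le_flatten) (use *[OF that] in \<open>simp add: algebra_simps\<close>)
  then have "flatten p a (x + y) - flatten p a y \<le> flatten p a x"
    by (intro le_flatten) (simp add: algebra_simps)
  then show "flatten p a (x + y) \<le> flatten p a x + flatten p a y" by simp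
next
  fix r :: real and x assume r: "0 < r"
  have "inverse r * flatten p a (r *\<^sub>R x) \<le> flatten p a x"
  proof (rule le_flatten)
    fix t :: real assume t: "0 \<le> t"
    have "flatten p a (r *\<^sub>R x) \<le> p (r *\<^sub>R x + (r * t) *\<^sub>R a) - (r * t) * p a"
      by (rule flatten_le) (use p r t in auto)
    also have "r *\<^sub>R x + (r * t) *\<^sub>R a = r *\<^sub>R (x + t *\<^sub>R a)"
      by (simp add: algebra_simps)
    also have "p \<dots> = r * p (x + t *\<^sub>R a)"
      by (rule sublinear_scaleR[OF p r])
    finally show "inverse r * flatten p a (r *\<^sub>R x) \<le> p (x + t *\<^sub>R a) - t * p a"
      using r by (simp add: field_simps)
  qed
  then show "flatten p a (r *\<^sub>R x) \<le> r * flatten p a x"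
    using r by (simp add: field_simps)
qed

lemma flatten_le_self: "sublinear p \<Longrightarrow> flatten p a x \<le> p x"
  using flatten_le[of p 0 a x] by simp

text \<open>Zorn's lemma applies because the pointwise infimum of a chain is again sublinear; it is
  finite, as every sublinear \<open>q \<le> p\<close> satisfies
  \<open>- p (- x) \<le> q x\<close>.\<close>

lemma ex_minimal_sublinear:
  assumes p: "sublinear p"
  shows "\<exists>q. sublinear q \<and> q \<le> p \<and> (\<forall>q'. sublinear q' \<and> q' \<le> q \<longrightarrow> q' = q)"
proof -
  define A where "A = {q. sublinear q \<and> q \<le> p}"
  have "\<exists>m\<in>A. \<forall>a\<in>A. m \<ge> a \<longrightarrow> a = m"
  proof (rule predicate_Zorn)
    show "partial_order_on A (relation_of (\<ge>) A)"
      by (rule partial_order_on_relation_ofI) auto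
  next
    fix C assume C: "C \<in> Chains (relation_of (\<ge>) A)"
    show "\<exists>u\<in>A. \<forall>a\<in>C. u \<le> a"
    proof (cases "C = {}")
      case True
      then show ?thesis using p by (auto simp: A_def)
    next
      case False
      have CA: "C \<subseteq> A" and tot: "\<And>q q'. q \<in> C \<Longrightarrow> q' \<in> C \<Longrightarrow> q \<le> q' \<or> q' \<le> q"
        using C by (auto simp: Chains_def relation_of_def)
      have sub: "sublinear q" "q x \<le> p x" if "q \<in> C" for q x
        using that CA by (auto simp: A_def le_fun_def)
      define u where "u x = (INF q\<in>C. q x)" for x
      have bdd: "bdd_below ((\<lambda>q. q x) ` C)" for x
      proof (rule bdd_belowI2)
        fix q assume "q \<in> C"
        then show "- p (- x) \<le> q x"
          using sublinear_minus[OF sub(1), of q x] sub(2)[of q "-x"] by simp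
      qed
      have le: "u x \<le> q x" if "q \<in> C" for q x
        unfolding u_def by (rule cINF_lower[OF bdd that])
      have ge: "c \<le> u x" if "\<And>q. q \<in> C \<Longrightarrow> c \<le> q x" for c x
        unfolding u_def by (rule cINF_greatest[OF False that])
      \<comment> \<open>The smaller of two comparable functionals bounds both, so its own
        subadditivity gives the mixed estimate.\<close>
      have "u (x + y) \<le> q x + q' y" if "q \<in> C" "q' \<in> C" for q q' x y
        using tot[OF that]
      proof
        assume "q \<le> q'"
        then show ?thesis
          using le[OF that(1), of "x + y"] sublinear_add[OF sub(1)[OF that(1)], of x y]
          by (auto simp: le_fun_def intro: order_trans)
      next
        assume "q' \<le> q"
        then show ?thesis
          using le[OF that(2), of "x + y"] sublinear_add[OF sub(1)[OF that(2)], of x y]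
          by (smt (verit) le_fun_def)
      qed
      then have "u (x + y) - q x \<le> q' y" if "q \<in> C" "q' \<in> C" for q q' x y
        unfolding diff_le_eq add.commute[of "q' y"] using that .
      then have "u (x + y) - q x \<le> u y" if "q \<in> C" for q x y
        using that by (intro ge) auto
      then have "u (x + y) - u y \<le> u x" for x y
        by (intro ge) (simp add: algebra_simps)
      then have "u (x + y) \<le> u x + u y" for x y
        by (simp add: algebra_simps)
      moreover have "u (r *\<^sub>R x) \<le> r * u x" if "0 < r" for r x
      proof -
        have "inverse r * u (r *\<^sub>R x) \<le> u x"
        proof (rule ge)
          fix q assume q: "q \<in> C"
          show "inverse r * u (r *\<^sub>R x) \<le> q x"
            using le[OF q, of "r *\<^sub>R x"] sublinear_scaleR[OF sub(1)[OF q] that, of x] that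
            by (simp add: field_simps)
        qed
        then show ?thesis using that by (simp add: field_simps)
      qed
      ultimately have "sublinear u" by (simp add: sublinear_def)
      moreover have "u x \<le> p x" for x
        using False le sub(2) by (meson all_not_in_conv order_trans)
      ultimately show ?thesis
        using le by (auto simp: A_def le_fun_def intro!: bexI[of _ u])
    qed
  qed
  then show ?thesis
    unfolding A_def by (metis (no_types, lifting) mem_Collect_eq order_trans)
qed

text \<open>A minimal sublinear functional below \<open>flatten p a\<close> is additive, and its
  value at \<open>a\<close> is pinned because \<open>flatten p a (- a) \<le> - p a\<close>.\<close>

theorem Hahn_Banach_sublinear:
  fixes p :: "'a::real_vector \<Rightarrow> real"
  assumes p: "sublinear p"
  obtains u where "linear u" "\<And>x. u x \<le> p x" "u a = p a"
proof -
  obtain q where q: "sublinear q" and qp: "q \<le> flatten p a"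
    and min: "\<And>q'. sublinear q' \<Longrightarrow> q' \<le> q \<Longrightarrow> q' = q"
    using ex_minimal_sublinear[OF sublinear_flatten[OF p, of a]] by blast
  have "flatten q b = q" for b
    by (rule min) (auto simp: le_fun_def sublinear_flatten flatten_le_self q)
  \<comment> \<open>The parameter 1 in the infimum defining \<open>flatten q b x\<close> gives
    superadditivity.\<close>
  then have "q x + q b \<le> q (x + b)" for x b
    using flatten_le[OF q, of 1 b x] by simp
  then have add: "q (x + y) = q x + q y" for x y
    using sublinear_add[OF q, of x y] by (simp add: antisym)
  have neg: "q (- x) = - q x" for x
    using add[of x "-x"] sublinear_0[OF q] by simp
  have "q (r *\<^sub>R x) = r * q x" for r x
  proof (cases r "0 :: real" rule: linorder_cases)
    case less
    then show ?thesis
      using neg[of "(-r) *\<^sub>R x"] sublinear_scaleR[OF q, of "-r" x] by simp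
  qed (use sublinear_scaleR[OF q] sublinear_0[OF q] in auto)
  then have lin: "linear q"
    using add by (intro linearI) auto
  have qp': "q x \<le> p x" for x
    using qp flatten_le_self[OF p, of a x] by (auto simp: le_fun_def intro: order_trans)
  have "q (- a) \<le> flatten p a (- a)"
    using qp by (auto simp: le_fun_def)
  also have "\<dots> \<le> - p a"
    using flatten_le[OF p, of 1 a "-a"] sublinear_0[OF p] by simp
  finally have "q a = p a"
    using neg[of a] qp'[of a] by simp
  then show ?thesis using that lin qp' by blast
qed

section \<open>Complex linear functionals and the complex Hahn-Banach theorem\<close>

lemma clinear_functionalI:
  assumes "\<And>x y. \<phi> (x + y) = \<phi> x + \<phi> y" "\<And>c x. \<phi> (c *\<^sub>C x) = c * \<phi> x"
  shows "clinear_functional \<phi>"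
proof -
  interpret vector_space_pair "scaleC :: complex \<Rightarrow> 'a \<Rightarrow> 'a" "(*) :: complex \<Rightarrow> complex \<Rightarrow> complex"
    by (intro vector_space_pair.intro vector_space_scaleC) (unfold_locales, auto simp: algebra_simps)
  show ?thesis
    unfolding clinear_functional_def by unfold_locales (use assms in auto)
qed

lemma
  assumes "clinear_functional \<phi>"
  shows clinear_functional_add: "\<phi> (x + y) = \<phi> x + \<phi> y"
    and clinear_functional_scaleC: "\<phi> (c *\<^sub>C x) = c * \<phi> x"
proof -
  interpret Vector_Spaces.linear scaleC "(*)" \<phi>
    using assms by (simp add: clinear_functional_def)
  show "\<phi> (x + y) = \<phi> x + \<phi> y" "\<phi> (c *\<^sub>C x) = c * \<phi> x"
    by (rule add) (rule scale)
qed

text \<open>A real functional \<open>u \<le> p\<close> is the real part of a unique complex linear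
  one. Rotating the argument turns the one-sided bound on the real part into a bound on the
  modulus.\<close>

theorem Hahn_Banach_seminorm:
  fixes p :: "'a::complex_banach \<Rightarrow> real"
  assumes add: "\<And>x y. p (x + y) \<le> p x + p y" and scale: "\<And>c x. p (c *\<^sub>C x) = cmod c * p x"
  obtains \<phi> where "clinear_functional \<phi>" "\<And>x. cmod (\<phi> x) \<le> p x" "p a \<le> cmod (\<phi> a)"
proof -
  have "sublinear p"
    using add scale by (auto simp: sublinear_def simp flip: scaleC_of_real)
  then obtain u where u: "linear u" "\<And>x. u x \<le> p x" "u a = p a"
    using Hahn_Banach_sublinear[of p a] by blast
  define \<phi> where "\<phi> x = Complex (u x) (- u (\<i> *\<^sub>C x))" for x
  have u_scaleC: "u (c *\<^sub>C x) = Re c * u x + Im c * u (\<i> *\<^sub>C x)" for c x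
  proof -
    have "c = complex_of_real (Re c) + complex_of_real (Im c) * \<i>"
      by (simp add: complex_eq_iff)
    then have "c *\<^sub>C x = (complex_of_real (Re c) + complex_of_real (Im c) * \<i>) *\<^sub>C x"
      by (rule arg_cong)
    also have "\<dots> = Re c *\<^sub>R x + Im c *\<^sub>R \<i> *\<^sub>C x"
      by (simp only: scaleC_add_left scaleC_of_real flip: scaleC_scaleC)
    finally show ?thesis
      using u(1) by (simp add: linear_add linear_scale)
  qed
  have \<phi>: "clinear_functional \<phi>"
  proof (rule clinear_functionalI)
    show "\<phi> (x + y) = \<phi> x + \<phi> y" for x y
      using u(1) by (simp add: \<phi>_def scaleC_add_right linear_add complex_eq_iff)
    show "\<phi> (c *\<^sub>C x) = c * \<phi> x" for c x
      by (simp add: \<phi>_def u_scaleC[of c] u_scaleC[of "\<i> * c"] scaleC_scaleC complex_eq_iff algebra_simps)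
  qed
  have Re_\<phi>: "Re (\<phi> x) = u x" for x by (simp add: \<phi>_def)
  have "cmod (\<phi> x) \<le> p x" for x
  proof (cases "\<phi> x = 0")
    case True
    \<comment> \<open>Only \<open>0 \<le> p x\<close> is at stake; it follows from
      \<open>0 = p 0 \<le> p x + p (- x) = 2 * p x\<close>.\<close>
    then show ?thesis
      using add[of x "(-1) *\<^sub>C x"] scale[of "-1" x] scale[of 0 "x"]
        scaleC_add_left[of 1 "-1" x] scaleC_of_real[of 1 x] by simp
  next
    case False
    \<comment> \<open>This unimodular factor rotates \<open>\<phi> x\<close> onto the positive real
      axis, where the modulus equals the real part.\<close>
    define c where "c = cnj (sgn (\<phi> x))"
    have "cmod c = 1" using False by (simp add: c_def norm_sgn)
    have "\<phi> (c *\<^sub>C x) = complex_of_real (cmod (\<phi> x))"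
    proof -
      have "c * \<phi> x = complex_of_real (cmod (\<phi> x))"
        using False by (simp add: c_def sgn_eq complex_norm_square[symmetric] mult.commute field_simps power2_eq_square)
      then show ?thesis
        using \<phi> by (simp add: clinear_functional_scaleC)
    qed
    then have "cmod (\<phi> x) = u (c *\<^sub>C x)"
      using Re_\<phi>[of "c *\<^sub>C x"] by simp
    also have "\<dots> \<le> p x"
      using u(2)[of "c *\<^sub>C x"] scale[of c x] \<open>cmod c = 1\<close> by simp
    finally show ?thesis .
  qed
  moreover have "p a \<le> cmod (\<phi> a)"
    using complex_Re_le_cmod[of "\<phi> a"] Re_\<phi>[of a] u(3) by simp
  ultimately show ?thesis using that \<phi> by blast
qed

lemma scaleC_minus1: "(- 1) *\<^sub>C x = - x"
  using scaleC_of_real[of "-1" x] by simp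

lemma scaleC_zero_left [simp]: "0 *\<^sub>C x = 0"
  using scaleC_of_real[of 0 x] by simp

lemma scaleC_zero_right [simp]: "c *\<^sub>C (0 :: 'a::complex_banach) = 0"
  using scaleC_add_right[of c 0 "0 :: 'a"] by simp

lemma scaleC_scaleR: "c *\<^sub>C r *\<^sub>R x = r *\<^sub>R c *\<^sub>C x"
  by (simp add: scaleC_scaleC mult.commute flip: scaleC_of_real)

section \<open>Uniform boundedness\<close>

text \<open>The closed sets \<open>C n\<close>, on which \<open>F\<close> is bounded by
  \<open>n\<close>, cover the space, so by Baire's theorem one of them contains a ball; differences
  of points of that ball bound \<open>F\<close> near 0.\<close>

lemma uniform_boundedness:
  fixes F :: "('a::banach \<Rightarrow> 'b::real_normed_vector) set"
  assumes lin: "\<And>f. f \<in> F \<Longrightarrow> bounded_linear f"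
    and bdd: "\<And>x. \<exists>B. \<forall>f\<in>F. norm (f x) \<le> B"
  obtains B where "0 < B" "\<And>f x. f \<in> F \<Longrightarrow> norm (f x) \<le> B * norm x"
proof -
  define C where "C n = {x. \<forall>f\<in>F. norm (f x) \<le> real n}" for n
  have closed: "closed (C n)" for n
  proof -
    have "C n = (\<Inter>f\<in>F. {x. norm (f x) \<le> real n})" by (auto simp: C_def)
    moreover have "closed {x. norm (f x) \<le> real n}" if "f \<in> F" for f
      by (intro closed_Collect_le continuous_on_norm continuous_on_const
          linear_continuous_on[OF lin[OF that]])
    ultimately show ?thesis by auto
  qed
  have "\<Union>(range C) = UNIV"
  proof -
    have "\<exists>n. x \<in> C n" for x
    proof -
      obtain B where "\<forall>f\<in>F. norm (f x) \<le> B" using bdd by blast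
      moreover obtain n where "B \<le> real n" using real_arch_simple by blast
      ultimately show ?thesis by (auto simp: C_def intro: order_trans)
    qed
    then show ?thesis by blast
  qed
  moreover have "euclidean interior_of \<Union>(range C) = {}" if "\<And>n. interior (C n) = {}"
    by (rule Baire_category_alt)
      (use that closed in \<open>auto simp: completely_metrizable_space_euclidean\<close>)
  ultimately have "\<exists>n. interior (C n) \<noteq> {}" by (metis UNIV_not_empty euclidean_interior_of interior_UNIV)
  then obtain n a e where e: "0 < e" "cball a e \<subseteq> C n"
    by (metis all_not_in_conv mem_interior_cball)
  show ?thesis
  proof (rule that)
    \<comment> \<open>Vectors of norm \<open>e\<close> are differences of two points of the ball,
      which gives \<open>2 * n / e\<close>; the added 1 keeps the constant positive when
      \<open>n = 0\<close>.\<close>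
    show "0 < (2 * real n + 1) / e" using e by (simp add: add_nonneg_pos)
  next
    fix f x assume f: "f \<in> F"
    interpret f: bounded_linear f by (rule lin[OF f])
    show "norm (f x) \<le> (2 * real n + 1) / e * norm x"
    proof (cases "x = 0")
      case False
      define z where "z = (e / norm x) *\<^sub>R x"
      have "norm (f a) \<le> n" "norm (f (a + z)) \<le> n"
        using e f False by (auto simp: C_def z_def subset_iff dist_norm)
      then have "norm (f z) \<le> 2 * real n"
        using norm_triangle_ineq4[of "f (a + z)" "f a"] by (simp add: f.add)
      then have "e * norm (f x) \<le> 2 * real n * norm x"
        using e False by (simp add: z_def f.scaleR field_simps)
      then have "e * norm (f x) \<le> (2 * real n + 1) * norm x"
        by (simp add: distrib_right add_increasing2)
      then show ?thesis using e by (simp add: field_simps)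
    qed (simp add: f.zero)
  qed
qed

section \<open>Locally convex spaces\<close>

locale locally_convex =
  fixes \<tau> :: "'a::complex_banach topology"
  assumes locally_convex: "locally_convex_topology \<tau>"
begin

lemma topspace_eq [simp]: "topspace \<tau> = UNIV"
  using locally_convex by (simp add: locally_convex_topology_def)

lemma continuous_map_translate: "continuous_map \<tau> \<tau> (\<lambda>x. a + x)"
proof -
  have add: "continuous_map (prod_topology \<tau> \<tau>) \<tau> (\<lambda>(x, y). x + y)"
    using locally_convex by (simp add: locally_convex_topology_def)
  have "continuous_map \<tau> (prod_topology \<tau> \<tau>) (\<lambda>x. (a, x))"
    by (simp add: continuous_map_paired)
  from continuous_map_compose[OF this add] show ?thesis
    by (simp add: o_def)
qed

lemma continuous_map_scaleC_prod:
  "continuous_map (prod_topology euclidean \<tau>) \<tau> (\<lambda>(c, x). c *\<^sub>C x)"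
  using locally_convex by (simp add: locally_convex_topology_def)

lemma continuous_map_scaleC: "continuous_map \<tau> \<tau> (\<lambda>x. c *\<^sub>C x)"
proof -
  have "continuous_map \<tau> (prod_topology euclidean \<tau>) (\<lambda>x. (c, x))"
    by (simp add: continuous_map_paired)
  from continuous_map_compose[OF this continuous_map_scaleC_prod] show ?thesis
    by (simp add: o_def)
qed

lemma continuous_map_scaleC_left: "continuous_map euclidean \<tau> (\<lambda>c. c *\<^sub>C x)"
proof -
  have "continuous_map euclidean (prod_topology euclidean \<tau>) (\<lambda>c :: complex. (c, x))"
    by (simp add: continuous_map_paired)
  from continuous_map_compose[OF this continuous_map_scaleC_prod] show ?thesis
    by (simp add: o_def)
qed

lemma openin_vimage_affine:
  assumes "openin \<tau> U"
  shows "openin \<tau> {x. c *\<^sub>C (a + x) \<in> U}"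
  using openin_continuous_map_preimage[OF continuous_map_compose[OF continuous_map_translate[of a]
        continuous_map_scaleC[of c]] assms] by (simp add: o_def)

text \<open>The absolutely convex neighbourhoods of 0. Containing an open set, rather than being
  open, admits sets such as \<open>{x. cmod (pair x y) \<le> 1}\<close>.\<close>

definition zero_disc :: "'a set \<Rightarrow> bool" where
  "zero_disc W \<longleftrightarrow> convex W \<and> (\<forall>c x. cmod c \<le> 1 \<longrightarrow> x \<in> W \<longrightarrow> c *\<^sub>C x \<in> W) \<and>
     (\<exists>V. openin \<tau> V \<and> 0 \<in> V \<and> V \<subseteq> W)"

lemma zero_disc_convex: "zero_disc W \<Longrightarrow> convex W"
  by (simp add: zero_disc_def)

lemma zero_disc_scaleC: "zero_disc W \<Longrightarrow> cmod c \<le> 1 \<Longrightarrow> x \<in> W \<Longrightarrow> c *\<^sub>C x \<in> W"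
  by (simp add: zero_disc_def)

lemma zero_disc_scaleR: "zero_disc W \<Longrightarrow> 0 \<le> r \<Longrightarrow> r \<le> 1 \<Longrightarrow> x \<in> W \<Longrightarrow> r *\<^sub>R x \<in> W"
  using zero_disc_scaleC[of W "complex_of_real r" x] by (simp add: scaleC_of_real)

lemma zero_disc_nhd:
  assumes "zero_disc W"
  obtains V where "openin \<tau> V" "0 \<in> V" "V \<subseteq> W"
  using assms by (auto simp: zero_disc_def)

lemma zero_disc_UNIV: "zero_disc UNIV"
  unfolding zero_disc_def using openin_topspace[of \<tau>] by (metis UNIV_I convex_UNIV subset_UNIV topspace_eq)

lemma zero_disc_Int: "zero_disc W \<Longrightarrow> zero_disc W' \<Longrightarrow> zero_disc (W \<inter> W')"
  unfolding zero_disc_def by (meson IntD1 IntD2 IntI convex_Int inf_mono openin_Int)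

text \<open>For \<open>r > 0\<close> this is \<open>W\<close> scaled by \<open>1 / r\<close>, whose
  polar is \<open>r\<close> times that of \<open>W\<close>; this is how a fixed error bound is later
  made small.\<close>

lemma zero_disc_dilate:
  assumes W: "zero_disc W"
  shows "zero_disc {x. r *\<^sub>R x \<in> W}"
proof -
  obtain V where V: "openin \<tau> V" "0 \<in> V" "V \<subseteq> W" using zero_disc_nhd[OF W] .
  have "convex {x. r *\<^sub>R x \<in> W}"
    using convex_linear_vimage[OF _ zero_disc_convex[OF W], of "\<lambda>x. r *\<^sub>R x"]
    by (simp add: vimage_def linear_iff scaleR_right_distrib)
  moreover have "openin \<tau> {x. r *\<^sub>R x \<in> V}"
    using openin_vimage_affine[OF V(1), of "complex_of_real r" 0] by (simp add: scaleC_of_real)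
  ultimately show ?thesis
    using V zero_disc_scaleC[OF W] unfolding zero_disc_def
    by (auto simp: simp flip: scaleC_scaleR intro!: exI[of _ "{x. r *\<^sub>R x \<in> V}"])
qed

text \<open>The disc is the largest balanced subset of a convex neighbourhood \<open>C\<close>:
  convex as an intersection of preimages of \<open>C\<close>, and a neighbourhood of 0 by joint
  continuity of scalar multiplication at \<open>(0, 0)\<close>.\<close>

lemma ex_zero_disc:
  assumes U: "openin \<tau> U" "0 \<in> U"
  obtains W where "zero_disc W" "W \<subseteq> U"
proof -
  have "neighbourhood_base_of convex \<tau>"
    using locally_convex by (simp add: locally_convex_topology_def)
  then have "\<exists>V C. openin \<tau> V \<and> convex C \<and> 0 \<in> V \<and> V \<subseteq> C \<and> C \<subseteq> U"
    using U unfolding neighbourhood_base_of by simp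
  then obtain V C where V: "openin \<tau> V" "convex C" "0 \<in> V" "V \<subseteq> C" "C \<subseteq> U"
    by blast
  let ?P = "{p. (case p of (c, x) \<Rightarrow> c *\<^sub>C x) \<in> V}"
  have "openin (prod_topology euclidean \<tau>) ?P"
    using openin_continuous_map_preimage[OF continuous_map_scaleC_prod V(1)] by simp
  moreover have "(0, 0) \<in> ?P" using V(3) by simp
  ultimately obtain D V' where D: "open D" "0 \<in> D" "openin \<tau> V'" "0 \<in> V'" "D \<times> V' \<subseteq> ?P"
    unfolding openin_prod_topology_alt by (metis open_openin)
  obtain d where d: "0 < d" "ball 0 d \<subseteq> D" using D open_contains_ball by blast
  define W where "W = {x. \<forall>c. cmod c \<le> 1 \<longrightarrow> c *\<^sub>C x \<in> C}"
  have "convex W"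
    unfolding W_def convex_def using \<open>convex C\<close>
    by (auto simp: convex_def scaleC_add_right scaleC_scaleR)
  moreover have "c *\<^sub>C x \<in> W" if "cmod c \<le> 1" "x \<in> W" for c x
    using that mult_le_one[of _ "cmod c"] by (auto simp: W_def scaleC_scaleC norm_mult)
  moreover have "{x. (2 / d) *\<^sub>R x \<in> V'} \<subseteq> W"
  proof (clarsimp simp: W_def)
    fix x and c :: complex assume x: "(2 / d) *\<^sub>R x \<in> V'" and c: "cmod c \<le> 1"
    \<comment> \<open>The factor \<open>d / 2\<close> keeps the modulus of \<open>k\<close> strictly
      below \<open>d\<close>; the factor \<open>2 / d\<close> on \<open>x\<close> cancels
      it.\<close>
    define k where "k = c * complex_of_real (d / 2)"
    have "cmod k < d"
      using c d(1) mult_right_mono[OF c, of "d / 2"] by (simp add: k_def norm_mult)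
    then have "k \<in> D"
      using d(2) by auto
    then have "k *\<^sub>C (2 / d) *\<^sub>R x \<in> V"
      using D(5) x by auto
    also have "k *\<^sub>C (2 / d) *\<^sub>R x = c *\<^sub>C (d / 2) *\<^sub>R (2 / d) *\<^sub>R x"
      unfolding k_def by (simp only: scaleC_of_real flip: scaleC_scaleC)
    also have "\<dots> = c *\<^sub>C x"
      using d(1) by simp
    finally show "c *\<^sub>C x \<in> C" using V(4) by auto
  qed
  moreover have "openin \<tau> {x. (2 / d) *\<^sub>R x \<in> V'}"
    using openin_vimage_affine[OF D(3), of "complex_of_real (2 / d)" 0] by (simp only: scaleC_of_real add_0)
  moreover have "0 \<in> {x. (2 / d) *\<^sub>R x \<in> V'}" using D(4) by simp
  ultimately have "zero_disc W" unfolding zero_disc_def by blast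
  moreover have "W \<subseteq> C"
  proof
    fix x assume "x \<in> W"
    then have "1 *\<^sub>C x \<in> C" unfolding W_def by (auto simp del: of_real_1)
    then show "x \<in> C" using scaleC_of_real[of 1 x] by simp
  qed
  ultimately show ?thesis using that V(5) by blast
qed

text \<open>Small multiples of a fixed \<open>x\<close> are close to 0 by continuity in the scalar.
  The infimum in the Minkowski functional is therefore over a nonempty set.\<close>

lemma zero_disc_absorbs:
  assumes W: "zero_disc W"
  obtains t where "0 < t" "t *\<^sub>R x \<in> W"
proof -
  obtain V where V: "openin \<tau> V" "0 \<in> V" "V \<subseteq> W" using zero_disc_nhd[OF W] .
  have "open {c. c *\<^sub>C x \<in> V}"
    using openin_continuous_map_preimage[OF continuous_map_scaleC_left V(1)]
    by simp
  moreover have "0 \<in> {c. c *\<^sub>C x \<in> V}" using V(2) by simp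
  ultimately obtain e where e: "0 < e" "cball 0 e \<subseteq> {c. c *\<^sub>C x \<in> V}"
    using open_contains_cball by blast
  then have "complex_of_real e \<in> {c. c *\<^sub>C x \<in> V}" by (auto simp: subset_iff)
  then have "e *\<^sub>R x \<in> W" using V(3) by (auto simp: scaleC_of_real)
  then show ?thesis using that e(1) by blast
qed

section \<open>The Minkowski functional of a disc\<close>

definition minkowski :: "'a set \<Rightarrow> 'a \<Rightarrow> real" where
  "minkowski W x = Inf {t. 0 < t \<and> inverse t *\<^sub>R x \<in> W}"

context
  fixes W assumes W: "zero_disc W"
begin

lemma minkowski_set_nonempty: "{t. 0 < t \<and> inverse t *\<^sub>R x \<in> W} \<noteq> {}"
proof -
  obtain t where "0 < t" "t *\<^sub>R x \<in> W" using zero_disc_absorbs[OF W] .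
  then have "inverse t \<in> {t. 0 < t \<and> inverse t *\<^sub>R x \<in> W}" by simp
  then show ?thesis by blast
qed

lemma minkowski_le: "0 < t \<Longrightarrow> inverse t *\<^sub>R x \<in> W \<Longrightarrow> minkowski W x \<le> t"
  unfolding minkowski_def by (rule cInf_lower) (auto intro: bdd_belowI[of _ 0])

lemma minkowski_nonneg: "0 \<le> minkowski W x"
  unfolding minkowski_def by (rule cInf_greatest[OF minkowski_set_nonempty]) auto

lemma minkowski_less:
  assumes "minkowski W x < t"
  shows "inverse t *\<^sub>R x \<in> W"
proof -
  obtain s where s: "0 < s" "inverse s *\<^sub>R x \<in> W" "s < t"
    using cInf_lessD[OF minkowski_set_nonempty, of x t] assms by (auto simp: minkowski_def)
  then have "(s / t) *\<^sub>R inverse s *\<^sub>R x \<in> W"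
    by (intro zero_disc_scaleR[OF W, where r = "s / t"]) auto
  then show ?thesis using s by (simp add: field_simps)
qed

lemma minkowski_add: "minkowski W (x + y) \<le> minkowski W x + minkowski W y"
proof (rule field_le_epsilon)
  fix e :: real assume e: "0 < e"
  define s t where "s = minkowski W x + e / 2" and "t = minkowski W y + e / 2"
  have st: "minkowski W x < s" "minkowski W y < t" using e by (auto simp: s_def t_def)
  have pos: "0 < s" "0 < t" using st minkowski_nonneg[of x] minkowski_nonneg[of y] by linarith+
  have "(s / (s + t)) *\<^sub>R (inverse s *\<^sub>R x) + (t / (s + t)) *\<^sub>R (inverse t *\<^sub>R y) \<in> W"
    using pos st by (intro convexD[OF zero_disc_convex[OF W]] minkowski_less)
      (auto simp flip: add_divide_distrib)
  moreover have "(s / (s + t)) *\<^sub>R (inverse s *\<^sub>R x) = inverse (s + t) *\<^sub>R x"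
    "(t / (s + t)) *\<^sub>R (inverse t *\<^sub>R y) = inverse (s + t) *\<^sub>R y"
    using pos by (simp_all add: divide_inverse)
  ultimately have "inverse (s + t) *\<^sub>R (x + y) \<in> W"
    by (simp only: scaleR_right_distrib)
  then have "minkowski W (x + y) \<le> s + t" using pos by (intro minkowski_le) auto
  then show "minkowski W (x + y) \<le> minkowski W x + minkowski W y + e" by (simp add: s_def t_def)
qed

text \<open>For \<open>c \<noteq> 0\<close> one inequality holds because \<open>W\<close> is
  invariant under unimodular factors; the other is the same inequality for
  \<open>inverse c\<close>.\<close>

lemma minkowski_scaleC: "minkowski W (c *\<^sub>C x) = cmod c * minkowski W x"
proof -
  have le: "minkowski W (c *\<^sub>C x) \<le> cmod c * minkowski W x" if "c \<noteq> 0" for c x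
  proof -
    have "minkowski W (c *\<^sub>C x) / cmod c \<le> minkowski W x"
    proof (rule field_le_epsilon)
      fix e :: real assume e: "0 < e"
      let ?t = "minkowski W x + e"
      have t: "0 < ?t" using minkowski_nonneg[of x] e by simp
      have "(c / complex_of_real (cmod c)) *\<^sub>C inverse ?t *\<^sub>R x \<in> W"
        using e by (intro zero_disc_scaleC[OF W] minkowski_less) (auto simp: norm_divide)
      also have "(c / complex_of_real (cmod c)) *\<^sub>C inverse ?t *\<^sub>R x
          = inverse (cmod c * ?t) *\<^sub>R c *\<^sub>C x"
        by (simp add: scaleC_scaleC divide_inverse mult_ac flip: scaleC_of_real)
      finally have "minkowski W (c *\<^sub>C x) \<le> cmod c * ?t"
        using that t by (intro minkowski_le) auto
      then show "minkowski W (c *\<^sub>C x) / cmod c \<le> ?t" using that by (simp add: field_simps)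
    qed
    then show ?thesis using that by (simp add: field_simps)
  qed
  show ?thesis
  proof (cases "c = 0")
    case True
    have "0 \<in> W" using W by (auto simp: zero_disc_def)
    then have "minkowski W 0 \<le> e" if "0 < e" for e
      using that by (intro minkowski_le) auto
    then have "minkowski W 0 \<le> 0" by (rule field_le_epsilon) auto
    then show ?thesis using True minkowski_nonneg[of 0] by simp
  next
    case False
    have "minkowski W (inverse c *\<^sub>C c *\<^sub>C x) \<le> cmod (inverse c) * minkowski W (c *\<^sub>C x)"
      using False by (intro le) auto
    moreover have "inverse c *\<^sub>C c *\<^sub>C x = x"
      using False scaleC_of_real[of 1 x] by (simp add: scaleC_scaleC)
    ultimately have "cmod c * minkowski W x \<le> minkowski W (c *\<^sub>C x)"
      using False by (simp add: norm_divide field_simps)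
    then show ?thesis using le[OF False] by (simp add: antisym)
  qed
qed

end

section \<open>Continuity of functionals and separation from a disc\<close>

lemma clinear_functional_continuous:
  assumes \<phi>: "clinear_functional \<phi>" and W: "zero_disc W" and le: "\<And>x. x \<in> W \<Longrightarrow> cmod (\<phi> x) \<le> 1"
  shows "\<phi> \<in> topological_dual \<tau>"
proof -
  obtain V where V: "openin \<tau> V" "0 \<in> V" "V \<subseteq> W" using zero_disc_nhd[OF W] .
  have nhd: "\<exists>T. openin \<tau> T \<and> a \<in> T \<and> T \<subseteq> {x. \<phi> x \<in> O'}" if O': "open O'" "\<phi> a \<in> O'" for O' a
  proof -
    obtain e where e: "0 < e" "ball (\<phi> a) e \<subseteq> O'" using openE[OF O'] by blast
    \<comment> \<open>On the translate by \<open>a\<close> of \<open>V\<close> scaled by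
      \<open>e / 2\<close>, the functional varies by at most \<open>e / 2 < e\<close>.\<close>
    let ?c = "complex_of_real (2 / e)"
    let ?T = "{x. ?c *\<^sub>C (- a + x) \<in> V}"
    have "?T \<subseteq> {x. \<phi> x \<in> O'}"
    proof safe
      fix x assume "?c *\<^sub>C (- a + x) \<in> V"
      then have "cmod (?c * (\<phi> (- a + x))) \<le> 1"
        using le V(3) clinear_functional_scaleC[OF \<phi>] by (metis subsetD)
      moreover have "\<phi> x = \<phi> a + \<phi> (- a + x)"
        using clinear_functional_add[OF \<phi>, of a "- a + x"] by simp
      ultimately have "cmod (\<phi> x - \<phi> a) < e" using e(1) by (simp add: norm_mult norm_divide field_simps)
      then show "\<phi> x \<in> O'" using e(2) by (auto simp: dist_norm norm_minus_commute)
    qed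
    moreover have "a \<in> ?T" using V(2) by simp
    ultimately show ?thesis
      using openin_vimage_affine[OF V(1)] by blast
  qed
  have "openin \<tau> {x. \<phi> x \<in> O'}" if "open O'" for O'
    by (rule openin_subopen[THEN iffD2]) (use nhd[OF that] in blast)
  then show ?thesis using \<phi> by (auto simp: topological_dual_def continuous_map)
qed

text \<open>Hahn-Banach for the Minkowski functional of \<open>W\<close>. As \<open>W\<close> may
  fail to be closed, that functional may equal 1 at \<open>x\<close>, so the last bound is not
  strict.\<close>

lemma zero_disc_separation:
  assumes W: "zero_disc W" and x: "x \<notin> W"
  obtains \<phi> where "\<phi> \<in> topological_dual \<tau>" "\<And>w. w \<in> W \<Longrightarrow> cmod (\<phi> w) \<le> 1" "1 \<le> cmod (\<phi> x)"
proof -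
  obtain \<phi> where \<phi>: "clinear_functional \<phi>" "\<And>z. cmod (\<phi> z) \<le> minkowski W z" "minkowski W x \<le> cmod (\<phi> x)"
    using Hahn_Banach_seminorm[of "minkowski W" x] minkowski_add[OF W] minkowski_scaleC[OF W] by blast
  have "1 \<le> minkowski W x" using minkowski_less[OF W, of x 1] x by fastforce
  moreover have "minkowski W w \<le> 1" if "w \<in> W" for w using minkowski_le[OF W, of 1 w] that by simp
  ultimately show ?thesis
    using that[of \<phi>] \<phi> clinear_functional_continuous[OF \<phi>(1) W] by (meson order_trans)
qed

end

section \<open>Polars in a norming dual pair\<close>

context norming_dual_pair
begin

lemma pair_add_left: "pair (x + x') y = pair x y + pair x' y"
  and pair_scaleC_left: "pair (c *\<^sub>C x) y = c * pair x y"
  and pair_scaleC_right: "pair x (c *\<^sub>C y) = c * pair x y"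
  using clinear_functional_add[OF linear_left] clinear_functional_scaleC[OF linear_left]
    clinear_functional_scaleC[OF linear_right] by auto

lemma pair_scaleR_left: "pair (r *\<^sub>R x) y = r *\<^sub>R pair x y"
  using pair_scaleC_left[of "complex_of_real r" x y] by (simp add: scaleC_of_real scaleR_conv_of_real)

lemma pair_scaleR_right: "pair x (r *\<^sub>R y) = r *\<^sub>R pair x y"
  using pair_scaleC_right[of x "complex_of_real r" y] by (simp add: scaleC_of_real scaleR_conv_of_real)

lemma pair_diff_left: "pair (x - x') y = pair x y - pair x' y"
  using pair_add_left[of "x - x'" x' y] by simp

lemma cmod_pair_le: "cmod (pair x y) \<le> norm x * norm y"
proof -
  have le: "cmod (pair x y) \<le> norm x" if "norm y \<le> 1" for y
  proof -
    have "ereal (cmod (pair x y)) \<le> ereal (norm x)"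
      unfolding norming_left by (rule SUP_upper) (use that in auto)
    then show ?thesis by simp
  qed
  have "pair x y = norm y *\<^sub>R pair x (y /\<^sub>R norm y)"
    using pair_scaleR_right[of x 0 0] by (cases "y = 0") (simp_all add: pair_scaleR_right)
  moreover have "cmod (pair x (y /\<^sub>R norm y)) \<le> norm x"
    by (rule le) (cases "y = 0"; simp)
  ultimately show ?thesis
    by (metis abs_norm_cancel mult.commute mult_left_mono norm_ge_zero norm_scaleR)
qed

lemma bounded_linear_pair: "bounded_linear (\<lambda>x. pair x y)"
  by (rule bounded_linear_intro) (auto intro: pair_add_left pair_scaleR_left cmod_pair_le)

lemma norm_le_iff_pair:
  "norm x \<le> K \<longleftrightarrow> (\<forall>y. norm y \<le> 1 \<longrightarrow> cmod (pair x y) \<le> K)"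
proof -
  have "norm x \<le> K \<longleftrightarrow> ereal (norm x) \<le> ereal K" by simp
  then show ?thesis unfolding norming_left by (simp add: SUP_le_iff)
qed

end

section \<open>Norm balls and polars under a consistent topology\<close>

locale consistent_dual_pair = norming_dual_pair pair + locally_convex \<tau>
  for pair :: "'a::complex_banach \<Rightarrow> 'b::complex_banach \<Rightarrow> complex" and \<tau> :: "'a topology" +
  assumes consistent: "consistent_topology pair \<tau>"
begin

lemma topological_dual_eq: "topological_dual \<tau> = range (\<lambda>y x. pair x y)"
  using consistent by (simp add: consistent_topology_def)

lemma continuous_map_pair: "continuous_map \<tau> euclidean (\<lambda>x. pair x y)"
  using topological_dual_eq by (auto simp: topological_dual_def)

text \<open>The norm is a supremum of moduli of \<open>\<tau>\<close>-continuous functionals, so the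
  ball is an intersection of \<open>\<tau>\<close>-closed sets.\<close>

lemma closedin_cball: "closedin \<tau> (cball 0 K)"
proof -
  have "closedin \<tau> {x. cmod (pair x y) \<le> K}" for y
    using closedin_continuous_map_preimage[OF continuous_map_pair[of y], of "cball 0 K"] by simp
  then have "closedin \<tau> (\<Inter>y\<in>{y. norm y \<le> 1}. {x. cmod (pair x y) \<le> K})"
    by (intro closedin_INT) (auto intro: exI[of _ 0])
  also have "(\<Inter>y\<in>{y. norm y \<le> 1}. {x. cmod (pair x y) \<le> K}) = cball 0 K"
    by (auto simp: norm_le_iff_pair)
  finally show ?thesis .
qed

definition polar :: "'a set \<Rightarrow> 'b set" where
  "polar W = {y. \<forall>x\<in>W. cmod (pair x y) \<le> 1}"

lemma polar_antimono: "W \<subseteq> W' \<Longrightarrow> polar W' \<subseteq> polar W"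
  by (auto simp: polar_def)

lemma zero_in_polar: "0 \<in> polar W"
  using pair_scaleR_right[of _ 0 0] by (simp add: polar_def)

lemma scaleR_polar: "y \<in> polar W \<Longrightarrow> r *\<^sub>R y \<in> polar {x. r *\<^sub>R x \<in> W}"
  by (auto simp: polar_def pair_scaleR_right simp flip: pair_scaleR_left)

text \<open>A point outside \<open>W\<close> is separated from it by a
  \<open>\<tau>\<close>-continuous functional, which consistency turns into a member of the polar.
  The strict inequality stands in for closedness of \<open>W\<close>.\<close>

lemma bipolar:
  assumes "zero_disc W" "\<And>y. y \<in> polar W \<Longrightarrow> cmod (pair x y) < 1"
  shows "x \<in> W"
proof (rule ccontr)
  assume "x \<notin> W"
  then obtain \<phi> where \<phi>: "\<phi> \<in> topological_dual \<tau>" "\<And>w. w \<in> W \<Longrightarrow> cmod (\<phi> w) \<le> 1" "1 \<le> cmod (\<phi> x)"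
    using zero_disc_separation[OF assms(1)] by blast
  then obtain y where "\<phi> = (\<lambda>x. pair x y)" using topological_dual_eq by auto
  then show False using \<phi> assms(2)[of y] by (auto simp: polar_def)
qed

text \<open>The polar is pointwise bounded on the first space because \<open>W\<close> absorbs every
  point; norm completeness makes the bound uniform.\<close>

lemma polar_bounded:
  assumes W: "zero_disc W"
  obtains B where "0 < B" "\<And>x y. y \<in> polar W \<Longrightarrow> cmod (pair x y) \<le> B * norm x"
proof (rule uniform_boundedness[of "(\<lambda>y x. pair x y) ` polar W"])
  show "bounded_linear f" if "f \<in> (\<lambda>y x. pair x y) ` polar W" for f
    using that bounded_linear_pair by auto
next
  fix x
  obtain t where t: "0 < t" "t *\<^sub>R x \<in> W" using zero_disc_absorbs[OF W] .
  then have "t * cmod (pair x y) \<le> 1" if "y \<in> polar W" for y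
    using that by (auto simp: polar_def pair_scaleR_left dest!: bspec)
  then show "\<exists>B. \<forall>f\<in>(\<lambda>y x. pair x y) ` polar W. cmod (f x) \<le> B"
    using t(1) by (auto simp: field_simps intro!: exI[of _ "1 / t"])
next
  fix B :: real assume "0 < B" "\<And>f x. f \<in> (\<lambda>y x. pair x y) ` polar W \<Longrightarrow> cmod (f x) \<le> B * norm x"
  then show ?thesis using that[of B] by auto
qed

lemma tvs_bounded_cball: "tvs_bounded \<tau> (cball 0 K)"
  unfolding tvs_bounded_def
proof (intro allI impI)
  fix U assume U: "openin \<tau> U \<and> 0 \<in> U"
  obtain W where W: "zero_disc W" "W \<subseteq> U" using ex_zero_disc[of U] U by blast
  obtain B where B: "0 < B" "\<And>x y. y \<in> polar W \<Longrightarrow> cmod (pair x y) \<le> B * norm x"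
    using polar_bounded[OF W(1)] by blast
  \<comment> \<open>Dividing by \<open>c\<close> brings the values on the polar below 1; the added 1
    gives the strict inequality that \<open>bipolar\<close> needs.\<close>
  have "cball 0 K \<subseteq> (\<lambda>x. c *\<^sub>C x) ` U" if c: "B * \<bar>K\<bar> + 1 \<le> cmod c" for c
  proof
    fix x :: 'a assume x: "x \<in> cball 0 K"
    have pos: "0 < cmod c" using c B(1) mult_nonneg_nonneg[of B "\<bar>K\<bar>"] by linarith
    have "inverse c *\<^sub>C x \<in> W"
    proof (rule bipolar[OF W(1)])
      fix y assume "y \<in> polar W"
      then have "cmod (pair x y) \<le> B * norm x" by (rule B(2))
      also have "\<dots> \<le> B * \<bar>K\<bar>" using x B(1) by (intro mult_left_mono) auto
      finally show "cmod (pair (inverse c *\<^sub>C x) y) < 1"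
        using c pos by (simp add: pair_scaleC_left norm_mult norm_divide field_simps)
    qed
    moreover have "x = c *\<^sub>C inverse c *\<^sub>C x"
      using pos scaleC_of_real[of 1 x] by (simp add: scaleC_scaleC)
    ultimately show "x \<in> (\<lambda>x. c *\<^sub>C x) ` U" using W(2) by blast
  qed
  moreover have "0 < B * \<bar>K\<bar> + 1" using B(1) by (simp add: add_nonneg_pos)
  ultimately show "\<exists>r>0. \<forall>c. r \<le> cmod c \<longrightarrow> cball 0 K \<subseteq> (\<lambda>x. c *\<^sub>C x) ` U" by blast
qed

text \<open>This disc has \<open>y\<close> in its polar, so uniform approximation on polars yields
  approximation at each single \<open>y\<close>.\<close>

lemma zero_disc_pair: "zero_disc {x. cmod (pair x y) \<le> 1}"
proof -
  have "convex {x. cmod (pair x y) \<le> 1}"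
    using convex_linear_vimage[OF bounded_linear.linear[OF bounded_linear_pair] convex_cball, of y 0 1]
    by (simp add: vimage_def)
  moreover have "openin \<tau> {x. cmod (pair x y) < 1}"
    using openin_continuous_map_preimage[OF continuous_map_pair[of y], of "ball 0 1"] by simp
  moreover have "cmod (pair 0 y) < 1"
    using pair_scaleR_left[of 0 0 y] by simp
  ultimately show ?thesis
    unfolding zero_disc_def
    by (auto simp: pair_scaleC_left norm_mult intro: mult_le_one intro!: exI[of _ "{x. cmod (pair x y) < 1}"])
qed

text \<open>The polars of the discs are the equicontinuous subsets of the second space. The error \<open>c\<close> need not
  be small, since shrinking \<open>W\<close> enlarges its polar and \<open>\<phi>\<close> is homogeneous.\<close>

theorem range_pairI:
  assumes qc: "quasi_complete \<tau>"
    and hom: "\<And>r y. \<phi> (r *\<^sub>R y) = r *\<^sub>R \<phi> y"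
    and approx: "\<And>W. zero_disc W \<Longrightarrow> \<exists>x. norm x \<le> K \<and> (\<forall>y\<in>polar W. cmod (\<phi> y - pair x y) \<le> c)"
  shows "\<phi> \<in> range pair"
proof -
  define S where "S W = {x. norm x \<le> K \<and> (\<forall>y\<in>polar W. cmod (\<phi> y - pair x y) \<le> c)}" for W
  \<comment> \<open>The sets \<open>S W\<close> form a filter base: intersecting two discs enlarges
    the polar, so \<open>S (W \<inter> W')\<close> lies in both \<open>S W\<close> and
    \<open>S W'\<close>.\<close>
  define F where "F = (INF W\<in>Collect zero_disc. principal (S W))"
  have c: "0 \<le> c"
    using approx[OF zero_disc_UNIV] zero_in_polar by (meson norm_ge_zero order_trans)
  have in_F: "eventually (\<lambda>x. x \<in> S W) F" if "zero_disc W" for W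
    unfolding F_def by (rule eventually_INF1[of W]) (use that in \<open>auto simp: eventually_principal\<close>)
  have "F \<noteq> bot"
  proof -
    have "\<exists>k\<in>Collect zero_disc. principal (S k) \<le> inf (principal (S W)) (principal (S W'))"
      if "zero_disc W" "zero_disc W'" for W W'
      using polar_antimono[of "W \<inter> W'" W] polar_antimono[of "W \<inter> W'" W'] zero_disc_Int[OF that]
      by (intro bexI[of _ "W \<inter> W'"]) (auto simp: S_def)
    then have "F = bot \<longleftrightarrow> (\<exists>W\<in>Collect zero_disc. principal (S W) = bot)"
      unfolding F_def by (intro INF_filter_bot_base) auto
    then show ?thesis
      using approx by (auto simp: S_def principal_eq_bot_iff)
  qed
  \<comment> \<open>Approximants for the dilated disc are tested at \<open>r *\<^sub>R y\<close>, so
    homogeneity divides the error by \<open>r\<close>.\<close>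
  have scaled: "cmod (\<phi> y - pair x y) \<le> c / r"
    if "x \<in> S {x. r *\<^sub>R x \<in> W}" "y \<in> polar W" "0 < r" for x y W r
  proof -
    have "cmod (\<phi> (r *\<^sub>R y) - pair x (r *\<^sub>R y)) \<le> c"
      using that scaleR_polar[OF that(2), of r] by (auto simp: S_def)
    then have "r * cmod (\<phi> y - pair x y) \<le> c"
      using that(3) by (simp add: hom pair_scaleR_right flip: scaleR_diff_right)
    then show ?thesis using that(3) by (simp add: field_simps)
  qed
  have "tvs_cauchy_filter \<tau> F"
    unfolding tvs_cauchy_filter_def
  proof (intro allI impI)
    fix U assume U: "openin \<tau> U \<and> 0 \<in> U"
    obtain W where W: "zero_disc W" "W \<subseteq> U" using ex_zero_disc[of U] U by blast
    \<comment> \<open>Two approximants differ on the polar of \<open>W\<close> by at most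
      \<open>2 * c / r\<close>, which this choice makes strictly less than 1, as
      \<open>bipolar\<close> requires.\<close>
    define r where "r = 2 * c + 1"
    have r: "0 < r" using c by (simp add: r_def)
    have "x - x' \<in> W" if x: "x \<in> S {x. r *\<^sub>R x \<in> W}" "x' \<in> S {x. r *\<^sub>R x \<in> W}" for x x'
    proof (rule bipolar[OF W(1)])
      fix y assume y: "y \<in> polar W"
      have "cmod (pair (x - x') y) \<le> cmod (\<phi> y - pair x y) + cmod (\<phi> y - pair x' y)"
        using norm_triangle_ineq4[of "\<phi> y - pair x' y" "\<phi> y - pair x y"] by (simp add: pair_diff_left)
      also have "\<dots> \<le> c / r + c / r"
        using scaled[OF x(1) y r] scaled[OF x(2) y r] by simp
      also have "\<dots> < 1" using c by (simp add: r_def flip: add_divide_distrib)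
      finally show "cmod (pair (x - x') y) < 1" .
    qed
    then show "eventually (\<lambda>(x, y). x - y \<in> U) (F \<times>\<^sub>F F)"
      unfolding eventually_prod_same using in_F[OF zero_disc_dilate[OF W(1), of r]] W(2) by blast
  qed
  moreover have "F \<le> principal (cball 0 K)"
    using in_F[OF zero_disc_UNIV] by (auto simp: le_principal S_def elim: eventually_mono)
  moreover have "tvs_complete_set \<tau> (cball 0 K)"
    using qc tvs_bounded_cball closedin_cball by (auto simp: quasi_complete_def)
  ultimately obtain x where x: "limitin \<tau> (\<lambda>z. z) x F"
    using \<open>F \<noteq> bot\<close> unfolding tvs_complete_set_def by blast
  have "pair x y = \<phi> y" for y
  proof -
    have "cmod (\<phi> y - pair x y) \<le> e" if e: "0 < e" for e
    proof -
      \<comment> \<open>This makes the error \<open>c / r\<close> at most \<open>e / 2\<close>; the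
        other half comes from convergence to \<open>x\<close>, tested against
        \<open>y\<close>.\<close>
      define r where "r = 2 * c / e + 1"
      have r: "0 < r" using c e by (simp add: r_def add_nonneg_pos)
      define N where "N = {z. pair z y \<in> ball (pair x y) (e / 2)}"
      have "openin \<tau> N"
        using openin_continuous_map_preimage[OF continuous_map_pair[of y], of "ball (pair x y) (e / 2)"]
        by (simp add: N_def)
      moreover have "x \<in> N" using e by (simp add: N_def)
      ultimately have "eventually (\<lambda>z. z \<in> N) F" using x by (auto simp: limitin_def)
      moreover have "eventually (\<lambda>z. z \<in> S {z. r *\<^sub>R z \<in> {z. cmod (pair z y) \<le> 1}}) F"
        by (intro in_F zero_disc_dilate zero_disc_pair)
      ultimately have "eventually (\<lambda>z. z \<in> N \<and> z \<in> S {z. r *\<^sub>R z \<in> {z. cmod (pair z y) \<le> 1}}) F"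
        by (rule eventually_conj)
      then obtain z where z: "z \<in> N" "z \<in> S {z. r *\<^sub>R z \<in> {z. cmod (pair z y) \<le> 1}}"
        using eventually_happens'[OF \<open>F \<noteq> bot\<close>] by blast
      have "cmod (\<phi> y - pair z y) \<le> c / r"
        by (rule scaled[OF z(2) _ r]) (simp add: polar_def)
      also have "\<dots> \<le> e / 2" using c e r by (simp add: r_def field_simps)
      finally have "cmod (\<phi> y - pair z y) \<le> e / 2" .
      moreover have "cmod (pair z y - pair x y) < e / 2"
        using z(1) by (simp add: N_def dist_norm norm_minus_commute)
      ultimately show ?thesis
        using norm_triangle_ineq[of "\<phi> y - pair z y" "pair z y - pair x y"] by simp
    qed
    then have "cmod (\<phi> y - pair x y) \<le> 0" by (rule field_le_epsilon) simp
    then show ?thesis by simp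
  qed
  then have "\<phi> = pair x" by auto
  then show ?thesis by blast
qed

end

section \<open>Approximation of the Y-integral\<close>

lemma csubspaceD:
  assumes "csubspace S"
  shows "0 \<in> S" "x \<in> S \<Longrightarrow> y \<in> S \<Longrightarrow> x - y \<in> S" "x \<in> S \<Longrightarrow> c *\<^sub>C x \<in> S"
proof -
  interpret vector_space "scaleC :: complex \<Rightarrow> 'a \<Rightarrow> 'a" by (rule vector_space_scaleC)
  show "0 \<in> S" "x \<in> S \<Longrightarrow> y \<in> S \<Longrightarrow> x - y \<in> S" "x \<in> S \<Longrightarrow> c *\<^sub>C x \<in> S"
    using assms by (auto simp: csubspace_def intro: subspace_0 subspace_diff subspace_scale)
qed

text \<open>One sequence serves all discs: density gives a member of it in the relatively open set
  of those \<open>z\<close> in \<open>X\<close> with \<open>x - z\<close> in \<open>V\<close>, for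
  every open \<open>V\<close> containing 0.\<close>

lemma (in locally_convex) separable_dense_sequence:
  assumes X: "csubspace X" and sep: "separable_space (subtopology \<tau> X)"
  obtains d :: "nat \<Rightarrow> 'a" where "range d \<subseteq> X" "\<And>W x. zero_disc W \<Longrightarrow> x \<in> X \<Longrightarrow> \<exists>n. x - d n \<in> W"
proof -
  obtain D where D: "countable D" "D \<subseteq> X" "subtopology \<tau> X closure_of D = X"
    using sep by (auto simp: separable_space_def)
  have "D \<noteq> {}" using D(3) csubspaceD(1)[OF X] by auto
  then have range: "range (from_nat_into D) = D" using D(1) by (rule range_from_nat_into)
  have "\<exists>n. x - from_nat_into D n \<in> W" if W: "zero_disc W" and x: "x \<in> X" for W x
  proof -
    obtain V where V: "openin \<tau> V" "0 \<in> V" "V \<subseteq> W" using zero_disc_nhd[OF W] .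
    define T where "T = {z. (- 1) *\<^sub>C (- x + z) \<in> V} \<inter> X"
    have "openin (subtopology \<tau> X) T"
      unfolding T_def by (intro openin_subtopology_Int openin_vimage_affine V(1))
    moreover have "x \<in> T" using x V(2) by (simp add: T_def)
    moreover have "x \<in> subtopology \<tau> X closure_of D" using x D(3) by simp
    ultimately have "\<exists>z. z \<in> D \<and> z \<in> T" by (simp add: in_closure_of)
    then obtain z where "z \<in> D" "z \<in> T" by blast
    then have "z \<in> D" "x - z \<in> W" using V(3) by (auto simp: T_def scaleC_minus1)
    then show ?thesis using range by (metis imageE)
  qed
  then show ?thesis using that[of "from_nat_into D"] range D(2) by blast
qed

context consistent_dual_pair
begin

text \<open>This makes sublevel sets of the seminorm of \<open>W\<close> measurable along scalarly measurable functions.\<close>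

lemma countable_norming_polar:
  fixes d :: "nat \<Rightarrow> 'a"
  assumes X: "csubspace X" and W: "zero_disc W"
    and d: "range d \<subseteq> X" "\<And>x. x \<in> X \<Longrightarrow> \<exists>n. x - d n \<in> W"
  obtains h :: "nat \<Rightarrow> 'b" where "range h \<subseteq> polar W"
    "\<And>x y. x \<in> X \<Longrightarrow> (\<And>k. cmod (pair x (h k)) \<le> 1) \<Longrightarrow> y \<in> polar W \<Longrightarrow> cmod (pair x y) \<le> 3"
proof -
  \<comment> \<open>\<open>h n\<close> detects whether \<open>d n\<close> exceeds 2 somewhere on the
    polar; if it does not, any element of the polar, such as 0, will do.\<close>
  have "\<exists>z\<in>polar W. \<forall>y\<in>polar W. 2 < cmod (pair (d n) y) \<longrightarrow> 2 < cmod (pair (d n) z)" for n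
    using zero_in_polar by blast
  then obtain h where h: "\<And>n. h n \<in> polar W"
    "\<And>n y. y \<in> polar W \<Longrightarrow> 2 < cmod (pair (d n) y) \<Longrightarrow> 2 < cmod (pair (d n) (h n))"
    by metis
  have "cmod (pair x y) \<le> 3"
    if x: "x \<in> X" "\<And>k. cmod (pair x (h k)) \<le> 1" and y: "y \<in> polar W" for x y
  \<comment> \<open>Exchanging \<open>x\<close> and \<open>d n\<close> costs 1, as their difference
    lies in \<open>W\<close>: more than 3 for \<open>x\<close> at \<open>y\<close> means more than 2
    for \<open>d n\<close> at \<open>y\<close>, hence at \<open>h n\<close>, hence more than 1 for
    \<open>x\<close> at \<open>h n\<close>.\<close>
  proof (rule ccontr)
    assume gt: "\<not> ?thesis"
    obtain n where n: "x - d n \<in> W" using d(2)[OF x(1)] by blast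
    have le: "cmod (pair x z - pair (d n) z) \<le> 1" if "z \<in> polar W" for z
      using n that by (auto simp: polar_def pair_diff_left dest!: bspec)
    have "2 < cmod (pair (d n) y)"
      using norm_triangle_ineq2[of "pair x y" "pair (d n) y"] le[OF y] gt by simp
    then have "2 < cmod (pair (d n) (h n))" by (rule h(2)[OF y])
    then show False
      using norm_triangle_ineq2[of "pair (d n) (h n)" "pair x (h n)"] le[OF h(1)[of n]] x(2)[of n]
      by (simp add: norm_minus_commute)
  qed
  then show ?thesis using that[of h] h(1) by blast
qed

text \<open>Neither bound depends on \<open>W\<close>, which is what \<open>range_pairI\<close>
  demands.\<close>

lemma ex_approx_Y_integral:
  assumes "finite_measure M" and meas: "\<And>y. (\<lambda>\<omega>. pair (F \<omega>) y) \<in> borel_measurable M"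
    and bdd: "\<And>\<omega>. \<omega> \<in> space M \<Longrightarrow> norm (F \<omega>) \<le> 1"
    and sep: "almost_separably_valued M \<tau> F" and A: "A \<in> sets M" and W: "zero_disc W"
  shows "\<exists>x. norm x \<le> measure M (space M) \<and>
    (\<forall>y\<in>polar W. cmod (Y_integral pair M A F y - pair x y) \<le> 6 * measure M (space M))"
proof -
  interpret finite_measure M by fact
  obtain N X where N: "N \<in> null_sets M" and X: "csubspace X" "separable_space (subtopology \<tau> X)"
    and F_X: "\<And>\<omega>. \<omega> \<in> space M - N \<Longrightarrow> F \<omega> \<in> X"
    using sep by (auto simp: almost_separably_valued_def)
  obtain d :: "nat \<Rightarrow> 'a" where d: "range d \<subseteq> X" "\<And>W x. zero_disc W \<Longrightarrow> x \<in> X \<Longrightarrow> \<exists>n. x - d n \<in> W"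
    using separable_dense_sequence[OF X] by blast
  obtain h :: "nat \<Rightarrow> 'b" where h: "range h \<subseteq> polar W"
    "\<And>x y. x \<in> X \<Longrightarrow> (\<And>k. cmod (pair x (h k)) \<le> 1) \<Longrightarrow> y \<in> polar W \<Longrightarrow> cmod (pair x y) \<le> 3"
    using countable_norming_polar[OF X(1) W d(1) d(2)[OF W]] by blast
  \<comment> \<open>Testing against the countably many \<open>h k\<close> instead of the whole polar
    keeps the set measurable; off \<open>N\<close> the values of \<open>F\<close> lie in
    \<open>X\<close>, where these tests control the whole polar.\<close>
  define A' where "A' n = {\<omega> \<in> space M. \<omega> \<in> A - N \<and> (\<forall>k. cmod (pair (F \<omega>) (h k) - pair (d n) (h k)) \<le> 1)}" for n
  have A_N: "A - N \<in> sets M" using A N by auto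
  have A': "A' n \<in> sets M" for n
    unfolding A'_def using A_N meas by measurable
  have A'_close: "cmod (pair (F \<omega>) y - pair (d n) y) \<le> 3" if "\<omega> \<in> A' n" "y \<in> polar W" for \<omega> n y
  proof -
    have "F \<omega> - d n \<in> X"
      by (rule csubspaceD(2)[OF X(1)]) (use F_X that(1) d(1) in \<open>auto simp: A'_def\<close>)
    then have "cmod (pair (F \<omega> - d n) y) \<le> 3"
      by (rule h(2)) (use that in \<open>auto simp: A'_def pair_diff_left\<close>)
    then show ?thesis by (simp add: pair_diff_left)
  qed
  have UN_A': "(\<Union>n. A' n) = A - N"
  proof (intro equalityI subsetI)
    fix \<omega> assume \<omega>: "\<omega> \<in> A - N"
    then have "\<omega> \<in> space M" using sets.sets_into_space[OF A] by auto
    then obtain n where "F \<omega> - d n \<in> W" using d(2)[OF W] F_X \<omega> by blast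
    then have "cmod (pair (F \<omega>) (h k) - pair (d n) (h k)) \<le> 1" for k
      using h(1) by (auto simp: polar_def subset_iff simp flip: pair_diff_left)
    then show "\<omega> \<in> (\<Union>n. A' n)" using \<omega> \<open>\<omega> \<in> space M\<close> by (auto simp: A'_def)
  qed (auto simp: A'_def)
  define B where "B = disjointed A'"
  have B: "B n \<in> sets M" for n
    using sets.range_disjointed_sets[of A' M] A' by (auto simp: B_def)
  have disj: "disjoint_family B" unfolding B_def by (rule disjoint_family_disjointed)
  have UN_B: "(\<Union>n. B n) = A - N" unfolding B_def UN_disjointed_eq UN_A' ..
  \<comment> \<open>The constant is a value of \<open>F\<close> on \<open>B n\<close> and not
    \<open>d n\<close>, because values of \<open>F\<close> have norm at most 1; passing through
    \<open>d n\<close> costs \<open>3 + 3\<close>. An empty \<open>B n\<close> gets 0.\<close>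
  have "\<exists>p. norm p \<le> 1 \<and> (\<forall>\<omega>\<in>B n. \<forall>y\<in>polar W. cmod (pair (F \<omega>) y - pair p y) \<le> 6)" for n
  proof (cases "B n = {}")
    case True
    then show ?thesis by (intro exI[of _ 0]) auto
  next
    case False
    then obtain \<omega>' where \<omega>': "\<omega>' \<in> B n" by blast
    have B_A': "B n \<subseteq> A' n" by (simp add: B_def disjointed_subset)
    have "cmod (pair (F \<omega>) y - pair (F \<omega>') y) \<le> 6" if "\<omega> \<in> B n" "y \<in> polar W" for \<omega> y
      using A'_close[OF subsetD[OF B_A' that(1)] that(2)] A'_close[OF subsetD[OF B_A' \<omega>'] that(2)]
        norm_triangle_ineq4[of "pair (F \<omega>) y - pair (d n) y" "pair (F \<omega>') y - pair (d n) y"] by simp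
    moreover have "norm (F \<omega>') \<le> 1" using \<omega>' sets.sets_into_space[OF B] bdd by blast
    ultimately show ?thesis by blast
  qed
  then obtain p where p: "\<And>n. norm (p n) \<le> 1"
    "\<And>n \<omega> y. \<omega> \<in> B n \<Longrightarrow> y \<in> polar W \<Longrightarrow> cmod (pair (F \<omega>) y - pair (p n) y) \<le> 6"
    by metis
  define m where "m n = measure M (B n)" for n
  have m_sums: "m sums measure M (A - N)"
    using finite_measure_UNION[OF _ disj] B unfolding m_def UN_B by auto
  have m_sum: "summable m" "suminf m \<le> measure M (space M)" and m_nonneg: "\<And>n. 0 \<le> m n"
    using m_sums sums_unique[OF m_sums] bounded_measure[of "A - N"]
    by (auto simp: m_def sums_iff)
  have norm_le: "norm (m n *\<^sub>R p n) \<le> m n" for n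
    using mult_left_mono[OF p(1) m_nonneg] m_nonneg by simp
  have p_norm_sum: "summable (\<lambda>n. norm (m n *\<^sub>R p n))"
    by (rule summable_comparison_test'[OF m_sum(1), of 0]) (use norm_le in simp)
  \<comment> \<open>The integral of the function equal to \<open>p n\<close> on each
    \<open>B n\<close>; the series converges absolutely because the masses \<open>m n\<close> are
    summable.\<close>
  define x where "x = (\<Sum>n. m n *\<^sub>R p n)"
  have "norm x \<le> (\<Sum>n. norm (m n *\<^sub>R p n))"
    unfolding x_def by (rule summable_norm[OF p_norm_sum])
  also have "\<dots> \<le> suminf m" by (rule suminf_le[OF norm_le p_norm_sum m_sum(1)])
  finally have "norm x \<le> measure M (space M)" using m_sum(2) by simp
  moreover have "cmod (Y_integral pair M A F y - pair x y) \<le> 6 * measure M (space M)"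
    if y: "y \<in> polar W" for y
  proof -
    have int: "integrable M (\<lambda>\<omega>. pair (F \<omega>) y)"
    proof (rule integrable_const_bound[OF _ meas])
      show "AE \<omega> in M. cmod (pair (F \<omega>) y) \<le> norm y"
      proof (rule AE_I2)
        fix \<omega> assume "\<omega> \<in> space M"
        then show "cmod (pair (F \<omega>) y) \<le> norm y"
          using cmod_pair_le[of "F \<omega>" y] bdd[of \<omega>] mult_right_mono[of "norm (F \<omega>)" 1 "norm y"] by simp
      qed
    qed
    have set_int: "set_integrable M S (\<lambda>\<omega>. pair (F \<omega>) y)" if "S \<in> sets M" for S
      unfolding set_integrable_def by (rule integrable_mult_indicator[OF that int])
    \<comment> \<open>The error contributed by \<open>B n\<close>, of modulus at most
      \<open>6 * m n\<close> by the choice of \<open>p n\<close>.\<close>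
    define a where "a = (\<lambda>n. (LINT \<omega>:B n|M. pair (F \<omega>) y) - m n *\<^sub>R pair (p n) y)"
    have "Y_integral pair M A F y = (LINT \<omega>:A - N|M. pair (F \<omega>) y)"
      unfolding Y_integral_def set_lebesgue_integral_def
    proof (rule integral_cong_AE)
      show "AE \<omega> in M. indicat_real A \<omega> *\<^sub>R pair (F \<omega>) y = indicat_real (A - N) \<omega> *\<^sub>R pair (F \<omega>) y"
        using AE_not_in[OF N] by eventually_elim (auto simp: indicator_def)
    qed (use A A_N meas in measurable)
    also have "\<dots> = (\<Sum>n. LINT \<omega>:B n|M. pair (F \<omega>) y)"
      unfolding UN_B[symmetric]
      by (rule lebesgue_integral_countable_add)
        (use B disj set_int[OF A_N] in \<open>auto simp: UN_B disjoint_family_on_def\<close>)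
    finally have Y: "Y_integral pair M A F y = (\<Sum>n. LINT \<omega>:B n|M. pair (F \<omega>) y)" .
    have "(\<lambda>n. pair (m n *\<^sub>R p n) y) sums pair x y"
      unfolding x_def using bounded_linear.sums[OF bounded_linear_pair summable_sums[OF
          summable_norm_cancel[OF p_norm_sum]]] .
    then have p_sums: "(\<lambda>n. m n *\<^sub>R pair (p n) y) sums pair x y"
      by (simp add: pair_scaleR_left)
    have a_le: "norm (a n) \<le> 6 * m n" for n
    proof -
      have int': "integrable M (\<lambda>\<omega>. indicat_real (B n) \<omega> *\<^sub>R (pair (F \<omega>) y - pair (p n) y))"
        using int B by (intro integrable_mult_indicator Bochner_Integration.integrable_diff) auto
      have "a n = (\<integral>\<omega>. indicat_real (B n) \<omega> *\<^sub>R (pair (F \<omega>) y - pair (p n) y) \<partial>M)"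
      proof -
        have const: "has_bochner_integral M (\<lambda>\<omega>. indicat_real (B n) \<omega> *\<^sub>R pair (p n) y) (m n *\<^sub>R pair (p n) y)"
          unfolding m_def using B[of n]
          by (intro has_bochner_integral_scaleR_left has_bochner_integral_real_indicator) (auto simp flip: less_top)
        have "has_bochner_integral M (\<lambda>\<omega>. indicat_real (B n) \<omega> *\<^sub>R pair (F \<omega>) y)
            (LINT \<omega>:B n|M. pair (F \<omega>) y)"
          using set_int[OF B[of n]] unfolding set_lebesgue_integral_def set_integrable_def
          by (rule has_bochner_integral_integrable)
        from has_bochner_integral_integral_eq[OF has_bochner_integral_diff[OF this const]] show ?thesis
          by (simp only: a_def scaleR_diff_right)
      qed
      also have "norm \<dots> \<le> (\<integral>\<omega>. indicat_real (B n) \<omega> * 6 \<partial>M)"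
      proof (rule order_trans[OF integral_norm_bound integral_mono[OF integrable_norm[OF int']]])
        show "integrable M (\<lambda>\<omega>. indicat_real (B n) \<omega> * 6)"
          using B[of n] by (simp add: less_top[symmetric])
        show "norm (indicat_real (B n) \<omega> *\<^sub>R (pair (F \<omega>) y - pair (p n) y)) \<le> indicat_real (B n) \<omega> * 6" for \<omega>
          using p(2)[OF _ y, of \<omega> n] by (simp add: indicator_def)
      qed
      also have "\<dots> = 6 * m n" using B[of n] by (simp add: m_def)
      finally show ?thesis .
    qed
    have a_norm_sum: "summable (\<lambda>n. norm (a n))"
      by (rule summable_comparison_test'[OF summable_mult[OF m_sum(1), of 6], of 0]) (use a_le in simp)
    have "norm (suminf a) \<le> (\<Sum>n. norm (a n))" by (rule summable_norm[OF a_norm_sum])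
    also have "\<dots> \<le> (\<Sum>n. 6 * m n)"
      by (rule suminf_le[OF a_le a_norm_sum summable_mult[OF m_sum(1)]])
    also have "\<dots> \<le> 6 * measure M (space M)" using m_sum by (simp add: suminf_mult)
    finally have "cmod (suminf a) \<le> 6 * measure M (space M)" .
    moreover have "suminf a + pair x y = Y_integral pair M A F y"
      using suminf_add[OF summable_norm_cancel[OF a_norm_sum] sums_summable[OF p_sums]] sums_unique[OF p_sums]
      by (simp add: a_def Y)
    ultimately show ?thesis by (simp flip: eq_diff_eq)
  qed
  ultimately show ?thesis by blast
qed

lemma Y_integral_in_range:
  assumes "quasi_complete \<tau>" "finite_measure M" "\<And>y. (\<lambda>\<omega>. pair (F \<omega>) y) \<in> borel_measurable M"
    "\<And>\<omega>. \<omega> \<in> space M \<Longrightarrow> norm (F \<omega>) \<le> 1" "almost_separably_valued M \<tau> F" "A \<in> sets M"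
  shows "Y_integral pair M A F \<in> range pair"
proof (rule range_pairI[OF assms(1)])
  show "Y_integral pair M A F (r *\<^sub>R y) = r *\<^sub>R Y_integral pair M A F y" for r y
    by (simp add: Y_integral_def pair_scaleR_right)
next
  show "\<exists>x. norm x \<le> measure M (space M) \<and>
    (\<forall>y\<in>polar W. cmod (Y_integral pair M A F y - pair x y) \<le> 6 * measure M (space M))"
    if "zero_disc W" for W
    by (rule ex_approx_Y_integral[OF assms(2-6) that])
qed

end

section \<open>Reduction to a finite measure and a function in the unit ball\<close>

theorem theorem4p4:
  fixes pair :: "'a::complex_banach \<Rightarrow> 'b::complex_banach \<Rightarrow> complex"
    and M :: "'w measure"
    and \<tau> :: "'a topology"
    and f :: "'w \<Rightarrow> 'a"
    and g :: "'w \<Rightarrow> real"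
  assumes "norming_dual_pair pair"
    and "sigma_finite_measure M"
    and "locally_convex_topology \<tau>"
    and "consistent_topology pair \<tau>"
    and "quasi_complete \<tau>"
    and "almost_separably_valued M \<tau> f"
    and "scalarly_integrable pair M f"
    and "integrable M g"
    and "\<And>\<omega>. \<omega> \<in> space M \<Longrightarrow> 0 \<le> g \<omega>"
    and "\<And>\<omega>. \<omega> \<in> space M \<Longrightarrow> norm (f \<omega>) \<le> g \<omega>"
  shows "Y_integrable pair M f"
proof -
  interpret consistent_dual_pair pair \<tau>
    using assms by (simp add: consistent_dual_pair_def locally_convex_def consistent_dual_pair_axioms_def)
  \<comment> \<open>The total mass of \<open>D\<close> is the integral of \<open>g\<close>. Where
    \<open>g\<close> vanishes, \<open>F\<close> is 0 because \<open>inverse 0 = 0\<close>, which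
    agrees with \<open>f\<close> being 0 there by the norm bound.\<close>
  define D where "D = density M (\<lambda>\<omega>. ennreal (g \<omega>))"
  define F where "F \<omega> = f \<omega> /\<^sub>R g \<omega>" for \<omega>
  have g [measurable]: "g \<in> borel_measurable M" using assms(8) by auto
  have g_nonneg: "AE \<omega> in M. 0 \<le> g \<omega>" using assms(9) by simp
  have f_meas [measurable]: "(\<lambda>\<omega>. pair (f \<omega>) y) \<in> borel_measurable M" for y
    using assms(7) unfolding scalarly_integrable_def by (blast intro: borel_measurable_integrable)
  have F_meas [measurable]: "(\<lambda>\<omega>. pair (F \<omega>) y) \<in> borel_measurable M" for y
    by (simp add: F_def pair_scaleR_left)
  have gF: "g \<omega> *\<^sub>R pair (F \<omega>) y = pair (f \<omega>) y" if "\<omega> \<in> space M" for \<omega> y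
    using assms(10)[OF that] pair_scaleR_left[of 0 0 y] by (cases "g \<omega> = 0") (auto simp: F_def pair_scaleR_left)
  have "finite_measure D"
  proof
    have "emeasure D (space D) = (\<integral>\<^sup>+\<omega>. ennreal (g \<omega>) \<partial>M)"
      by (simp add: D_def emeasure_density cong: nn_integral_cong)
    also have "\<dots> = ennreal (integral\<^sup>L M g)"
      using assms(8) g_nonneg by (rule nn_integral_eq_integral)
    finally show "emeasure D (space D) \<noteq> \<infinity>" by simp
  qed
  moreover have "norm (F \<omega>) \<le> 1" if "\<omega> \<in> space D" for \<omega>
    using assms(9,10)[of \<omega>] that by (cases "g \<omega> = 0") (auto simp: D_def F_def field_simps)
  moreover have "almost_separably_valued D \<tau> F"
  proof -
    obtain N X where N: "N \<in> null_sets M" and X: "csubspace X" "separable_space (subtopology \<tau> X)"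
      "f ` (space M - N) \<subseteq> X"
      using assms(6) by (auto simp: almost_separably_valued_def)
    have "N \<in> null_sets D"
      using N AE_not_in[OF N] unfolding D_def by (subst null_sets_density_iff) (auto elim: eventually_mono)
    moreover have "F ` (space D - N) \<subseteq> X"
      using X(3) csubspaceD(3)[OF X(1), of _ "complex_of_real (inverse (g _))"]
      by (auto simp: D_def F_def scaleC_of_real simp del: of_real_inverse)
    ultimately show ?thesis using X by (auto simp: almost_separably_valued_def)
  qed
  moreover have "(\<lambda>\<omega>. pair (F \<omega>) y) \<in> borel_measurable D" for y
    by (simp add: D_def)
  ultimately have "Y_integral pair D A F \<in> range pair" if "A \<in> sets M" for A
    using that assms(5) by (intro Y_integral_in_range) (auto simp: D_def)
  \<comment> \<open>The density \<open>g\<close> cancels the division by \<open>g\<close> in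
    \<open>F\<close>.\<close>
  moreover have "Y_integral pair D A F = Y_integral pair M A f" if [measurable]: "A \<in> sets M" for A
  proof
    fix y
    have "Y_integral pair D A F y = (\<integral>\<omega>. g \<omega> *\<^sub>R indicat_real A \<omega> *\<^sub>R pair (F \<omega>) y \<partial>M)"
      unfolding Y_integral_def set_lebesgue_integral_def D_def
      by (rule integral_density) (use g_nonneg in measurable)
    also have "\<dots> = Y_integral pair M A f y"
      unfolding Y_integral_def set_lebesgue_integral_def
      by (rule Bochner_Integration.integral_cong) (auto simp: indicator_def gF)
    finally show "Y_integral pair D A F y = Y_integral pair M A f y" .
  qed
  ultimately show ?thesis
    using assms(7) by (simp add: Y_integrable_def)
qed

end
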